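(* Let $f:\mathbb{T}\to\mathbb{R}$ be a continuous even function with mean value $0$ for which there are constants $c_1,c_2>0$ with $c_1|k|^{-2}\le\widehat f(k)\le c_2|k|^{-2}$ for all $k\in\mathbb{Z}\setminus\{0\}$. Let $\{x_1,\dots,x_m\}\subset\mathbb{T}$ be an arbitrary finite initial set ($m\ge1$) and let $(x_n)_{n\ge1}$ be any sequence in $\mathbb{T}$ extending it such that for every $n>m$ $$x_n\in\arg\min_{x\in\mathbb{T}}\sum_{k=1}^{n-1}f(x-x_k).$$ Then there is a constant $C>0$, independent of $n$, such that $$\left\|\sum_{k=1}^n f(x-x_k)\right\|_{L^\infty}\le C\,n^{1/3}\qquad\text{for infinitely many } n\in\mathbb{N}.$$
   Context: $\mathbb{T}=\mathbb{R}/\mathbb{Z}\cong[0,1)$ is the one-dimensional torus with Lebesgue (Haar) probability measure $dx$; $\widehat f(k)=\int_{\mathbb{T}}f(x)e^{-2\pi i kx}\,dx$. The $L^\infty$ norm is over $x\in\mathbb{T}$. If the minimum is attained at several points, any of them may be chosen. *)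

theory Defs
  imports "HOL-Analysis.Analysis" "HOL-Probability.Essential_Supremum"
begin

text \<open>
  The torus \<open>\<real>/\<int>\<close> is identified with its fundamental domain \<open>[0,1)\<close>; functions on it are
  functions on \<open>\<real>\<close> of period 1, so that differences of points may be formed in \<open>\<real>\<close>.
\<close>

definition torus :: "real measure" where
  "torus = lebesgue_on {0..<1}"

definition torus_fun :: "(real \<Rightarrow> real) \<Rightarrow> bool" where
  "torus_fun f \<longleftrightarrow> (\<forall>x. f (x + 1) = f x)"

definition fourier_coeff :: "(real \<Rightarrow> real) \<Rightarrow> int \<Rightarrow> complex" where
  "fourier_coeff f k =
     (LINT x|torus. complex_of_real (f x) * exp (- 2 * of_real pi * \<i> * of_int k * of_real x))"

definition Linf_norm :: "(real \<Rightarrow> real) \<Rightarrow> ereal" where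
  "Linf_norm g = esssup torus (\<lambda>x. ereal \<bar>g x\<bar>)"

end

theory Submission
  imports Defs
begin

text \<open>
  Write \<open>g\<^sub>n y = (\<Sum>k=1..n. f (y - x k))\<close> for the potential of the first \<open>n\<close> points and
  \<open>E\<^sub>n = (\<Sum>i=1..n. \<Sum>j=1..n. f (x i - x j))\<close> for their energy. Summable Fourier coefficients
  and continuity make \<open>f\<close> equal to its cosine series (\<open>cosine_series\<close>). As the coefficients are
  nonnegative, \<open>f\<close> is positive definite (\<open>cosine_series_positive_definite\<close>), so \<open>E\<^sub>n \<ge> 0\<close>.

  The greedy rule controls the energy from above. Since \<open>g\<^sub>n\<close> has mean zero, its minimum
  \<open>g\<^sub>n (x (n+1))\<close> is at most \<open>0\<close>, and \<open>E\<^sub>n\<^sub>+\<^sub>1 = E\<^sub>n + 2 g\<^sub>n (x (n+1)) + f 0\<close>. Two things follow.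
  First, \<open>E\<^sub>n\<close> is at most \<open>A n\<close> (\<open>energy_linear_bound\<close>). Second, the minimum cannot stay below
  \<open>- f 0\<close> from some \<open>n\<close> on, because the energy would then decrease linearly and become negative;
  so \<open>g\<^sub>n \<ge> - f 0\<close> everywhere for infinitely many \<open>n\<close>
  (\<open>potential_bounded_below_infinitely_often\<close>).

  The energy is comparable to the squared Sobolev norm of order \<open>-1\<close> of the point measure, and \<open>f\<close> smooths by two
  derivatives, so the linear bound says that the \<open>L\<^sup>2\<close> norm of the derivative of \<open>g\<^sub>n\<close> is
  \<open>O(n\<^sup>1\<^sup>/\<^sup>2)\<close>. What is used of this is the resulting Hoelder estimate with exponent 1/2. It comes
  without derivatives from positive definiteness: the Cauchy-Schwarz inequality for the form given by
  \<open>f\<close> bounds \<open>(g\<^sub>n u - g\<^sub>n v)\<^sup>2\<close> by \<open>2 E\<^sub>n (f 0 - f (u - v))\<close> (\<open>potential_oscillation_le\<close>), and the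
  decay of the coefficients gives \<open>f 0 - f t \<le> K t\<close> (\<open>cosine_series_increment_le\<close>).

  For the infinitely many good \<open>n\<close> the function \<open>g\<^sub>n\<close> has mean zero and a bounded negative part, so
  its \<open>L\<^sup>1\<close> norm is bounded. If it exceeded a large multiple \<open>L\<close> of \<open>n\<^sup>1\<^sup>/\<^sup>3\<close> somewhere, the
  Hoelder estimate would keep it above \<open>L / 2\<close> on an interval of length \<open>n\<^sup>-\<^sup>1\<^sup>/\<^sup>3\<close>, and that peak
  alone would carry more mass than the negative part can compensate (\<open>mean_zero_sup_bound\<close>). This is
  the interpolation inequality of Gagliardo and Nirenberg between \<open>L\<^sup>1\<close> and the derivative in \<open>L\<^sup>2\<close>.
\<close>

section \<open>Functions of period one\<close>

lemma periodic_add_int: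
  fixes f :: "real \<Rightarrow> 'a"
  assumes "\<And>x. f (x + 1) = f x"
  shows "f (x + of_int k) = f x"
proof (induction k rule: int_induct[where k = 0])
  case (step1 i)
  then show ?case using assms[of "x + of_int i"] by (simp add: add.assoc)
next
  case (step2 i)
  then show ?case using assms[of "x + of_int i - 1"] by (simp add: add_diff_eq)
qed simp

lemma periodic_frac:
  fixes f :: "real \<Rightarrow> 'a"
  assumes "\<And>x. f (x + 1) = f x"
  shows "f (frac x) = f x"
  using periodic_add_int[of f "frac x" "\<lfloor>x\<rfloor>", OF assms] by (simp add: frac_def)

lemma periodic_integral_shift:
  fixes f :: "real \<Rightarrow> real"
  assumes per: "\<And>x. f (x + 1) = f x" and cont: "continuous_on UNIV f"
  shows "integral {a..a+1} f = integral {0..1} f"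
proof -
  have int: "f integrable_on {u..v}" for u v
    by (intro integrable_continuous_real continuous_on_subset[OF cont]) auto
  define b where "b = frac a"
  have b: "0 \<le> b" "b \<le> 1" using frac_lt_1[of a] by (auto simp: b_def)
  have "integral {b..b+1} f = integral {a..a+1} (\<lambda>x. f (x + of_int (-\<lfloor>a\<rfloor>)))"
    using integral_shift_real_ivl[of b "of_int (-\<lfloor>a\<rfloor>)" "b+1" f] by (simp add: b_def frac_def algebra_simps)
  also have "\<dots> = integral {a..a+1} f"
    by (subst periodic_add_int[of f, OF per]) simp
  finally have 1: "integral {a..a+1} f = integral {b..b+1} f" by simp
  have "integral {1..b+1} f = integral {0..b} (\<lambda>x. f (x + 1))"
    using integral_shift_real_ivl[of 1 1 "b+1" f] by simp
  then have 2: "integral {1..b+1} f = integral {0..b} f" by (simp add: per)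
  show ?thesis
    using Henstock_Kurzweil_Integration.integral_combine[OF b int]
      Henstock_Kurzweil_Integration.integral_combine[of b 1 "b+1" f] b int 1 2 by simp
qed

lemma torus_integral_continuous:
  fixes g :: "real \<Rightarrow> 'b::euclidean_space"
  assumes "continuous_on UNIV g"
  shows "integrable torus g" and "(LINT x|torus. g x) = integral {0..1} g"
proof -
  have "g absolutely_integrable_on {0..1}"
    by (intro absolutely_integrable_continuous_real continuous_on_subset[OF assms]) auto
  then have "g absolutely_integrable_on {0..<1}"
    by (rule set_integrable_subset) auto
  then show int: "integrable torus g"
    unfolding torus_def by (simp add: absolutely_integrable_imp_integrable)
  have "integral {0..<1} g = integral {0..1} g"
    by (rule integral_spike_set; rule negligible_subset[of "{1}"]) auto
  then show "(LINT x|torus. g x) = integral {0..1} g"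
    using lebesgue_integral_eq_integral[OF int[unfolded torus_def]] by (simp add: torus_def)
qed

lemma Re_fourier_coeff:
  assumes "continuous_on UNIV f"
  shows "Re (fourier_coeff f k) = integral {0..1} (\<lambda>x. f x * cos (2 * pi * of_int k * x))"
proof -
  have c: "continuous_on UNIV (\<lambda>x. complex_of_real (f x) * exp (- 2 * of_real pi * \<i> * of_int k * of_real x))"
    by (intro continuous_intros assms)
  have "Re (fourier_coeff f k) =
     (LINT x|torus. Re (complex_of_real (f x) * exp (- 2 * of_real pi * \<i> * of_int k * of_real x)))"
    unfolding fourier_coeff_def by (rule integral_Re[symmetric, OF torus_integral_continuous(1)[OF c]])
  also have "\<dots> = (LINT x|torus. f x * cos (2 * pi * of_int k * x))"
    by (intro Bochner_Integration.integral_cong refl) (simp add: Re_exp)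
  also have "\<dots> = integral {0..1} (\<lambda>x. f x * cos (2 * pi * of_int k * x))"
    by (intro torus_integral_continuous continuous_intros assms)
  finally show ?thesis .
qed

section \<open>Cosine series of even functions\<close>

lemma cosine_integral:
  "integral {0..1} (\<lambda>x. cos (2 * pi * of_int j * x)) = (if j = 0 then 1 else 0)"
proof (cases "j = 0")
  case False
  have "((\<lambda>x. cos (2 * pi * of_int j * x)) has_integral
      sin (2 * pi * of_int j * 1) / (2 * pi * of_int j) - sin (2 * pi * of_int j * 0) / (2 * pi * of_int j)) {0..1}"
    using False
    by (intro fundamental_theorem_of_calculus)
      (auto intro!: derivative_eq_intros simp flip: has_real_derivative_iff_has_vector_derivative)
  moreover have "sin (2 * pi * of_int j) = 0" using sin_int_2pin[of j] by simp
  ultimately show ?thesis using False by (simp add: integral_unique)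
qed simp

lemma cosine_orthogonality:
  "integral {0..1} (\<lambda>x. cos (2 * pi * of_nat (Suc i) * x) * cos (2 * pi * of_nat k * x)) =
     (if Suc i = k then 1 / 2 else 0)"
proof -
  have eq: "(\<lambda>x. cos (2 * pi * of_nat (Suc i) * x) * cos (2 * pi * of_nat k * x)) =
     (\<lambda>x. (cos (2 * pi * of_int (int (Suc i) - int k) * x) + cos (2 * pi * of_int (int (Suc i) + int k) * x)) / 2)"
    unfolding cos_times_cos by (rule ext) (simp add: algebra_simps)
  have *: "integral {0..1} (\<lambda>x. cos (2 * pi * of_int j * x) + cos (2 * pi * of_int l * x))
     = (if j = 0 then 1 else 0) + (if l = 0 then 1 else 0)" for j l
    by (subst integral_add) (auto intro!: integrable_continuous_real continuous_intros simp: cosine_integral)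
  show ?thesis unfolding eq
    by (subst integral_divide, subst *) auto
qed

text \<open>
  An even function of period 1 is a continuous function of \<open>cos (2 \<pi> x)\<close>, hence by Weierstrass a
  uniform limit of polynomials in \<open>cos (2 \<pi> x)\<close>. Such polynomials are combinations of the functions
  \<open>cos (2 \<pi> k x)\<close>, so \<open>d\<close> is orthogonal to a sequence that converges to \<open>d\<close> itself.
\<close>

lemma even_periodic_zero_if_cosine_coeffs_zero:
  fixes d :: "real \<Rightarrow> real"
  assumes per: "\<And>x. d (x + 1) = d x" and cont: "continuous_on UNIV d"
    and even: "\<And>x. d (- x) = d x"
    and coeff: "\<And>k::nat. integral {0..1} (\<lambda>x. d x * cos (2 * pi * real k * x)) = 0"
  shows "d x = 0"
proof -
  have cont': "continuous_on S d" for S using cont continuous_on_subset by blast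
  \<comment> \<open>The extra factor \<open>cos (2 \<pi> k x)\<close> lets the product-to-sum formula lower \<open>n\<close> while \<open>k\<close> varies.\<close>
  have moments: "integral {0..1} (\<lambda>x. d x * cos (2 * pi * x) ^ n * cos (2 * pi * real k * x)) = 0" for n k
  proof (induction n arbitrary: k)
    case 0 then show ?case using coeff by simp
  next
    case (Suc n)
    show ?case
    proof (cases k)
      case 0
      then show ?thesis using Suc[of 1] by (simp add: mult_ac)
    next
      case (Suc j)
      have "(\<lambda>x. d x * cos (2 * pi * x) ^ Suc n * cos (2 * pi * real k * x)) =
         (\<lambda>x. (d x * cos (2 * pi * x) ^ n * cos (2 * pi * real (Suc (Suc j)) * x) +
              d x * cos (2 * pi * x) ^ n * cos (2 * pi * real j * x)) / 2)"
      proof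
        fix x
        have *: "cos (2 * pi * real k * x) * cos (2 * pi * x) =
           (cos (2 * pi * real (Suc (Suc j)) * x) + cos (2 * pi * real j * x)) / 2"
          unfolding cos_times_cos Suc by (simp add: algebra_simps)
        have "d x * cos (2 * pi * x) ^ Suc n * cos (2 * pi * real k * x) =
           d x * cos (2 * pi * x) ^ n * (cos (2 * pi * real k * x) * cos (2 * pi * x))"
          by (simp only: power_Suc mult_ac)
        then show "d x * cos (2 * pi * x) ^ Suc n * cos (2 * pi * real k * x) =
           (d x * cos (2 * pi * x) ^ n * cos (2 * pi * real (Suc (Suc j)) * x) +
              d x * cos (2 * pi * x) ^ n * cos (2 * pi * real j * x)) / 2"
          unfolding * by (simp only: distrib_left times_divide_eq_right)
      qed
      then show ?thesis
        using Suc.IH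
        by (simp only: integral_divide, subst integral_add)
          (auto intro!: integrable_continuous_real continuous_intros cont' simp del: of_nat_Suc)
    qed
  qed
  define G where "G y = d (arccos y / (2 * pi))" for y
  have contG: "continuous_on {-1..1} G"
    unfolding G_def by (intro continuous_on_compose2[OF cont] continuous_intros) auto
  have dG: "d x = G (cos (2 * pi * x))" if "x \<in> {0..1}" for x
  proof (cases "x \<le> 1/2")
    case True
    then have "2 * pi * x \<le> pi" by (simp add: mult_ac)
    then show ?thesis using that by (simp add: G_def arccos_cos)
  next
    case False
    have "cos (2 * pi * x) = cos (2 * pi * (1 - x))"
      by (simp add: algebra_simps cos_diff)
    moreover have "2 * pi * (1 - x) \<le> pi" using False by (simp add: algebra_simps)
    ultimately have "G (cos (2 * pi * x)) = d (1 - x)"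
      using that by (simp add: G_def arccos_cos)
    also have "\<dots> = d x" using per[of "-x"] even[of x] by simp
    finally show ?thesis by simp
  qed
  have "bounded (d ` {0..1})"
    by (intro compact_imp_bounded compact_continuous_image cont' compact_Icc)
  then obtain B where "\<forall>y\<in>d ` {0..1}. norm y \<le> B"
    unfolding bounded_iff by blast
  then have B: "\<bar>d x\<bar> \<le> B" if "x \<in> {0..1}" for x
    using that by simp
  have "integral {0..1} (\<lambda>x. d x ^ 2) \<le> 0"
  proof (rule field_le_epsilon)
    fix e :: real assume "e > 0"
    have B0: "B \<ge> 0" using B[of 0] by simp
    \<comment> \<open>Adding 1 to \<open>B\<close> avoids dividing by zero when \<open>d\<close> vanishes.\<close>
    define e' where "e' = e / (B + 1)"
    have e': "e' > 0" "B * e' \<le> e" using \<open>e > 0\<close> B0 by (auto simp: e'_def field_simps)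
    obtain p where p: "real_polynomial_function p" "\<And>y. y \<in> {-1..1} \<Longrightarrow> \<bar>G y - p y\<bar> < e'"
      using Stone_Weierstrass_real_polynomial_function[OF compact_Icc contG e'(1)] by metis
    obtain a n where pn: "p = (\<lambda>x. \<Sum>i\<le>n. a i * x ^ i)"
      using p(1) unfolding real_polynomial_function_iff_sum by blast
    have 0: "integral {0..1} (\<lambda>x. d x * p (cos (2 * pi * x))) = 0"
    proof -
      have "(\<lambda>x. d x * p (cos (2 * pi * x))) = (\<lambda>x. \<Sum>i\<le>n. a i * (d x * cos (2 * pi * x) ^ i))"
        unfolding pn by (simp add: sum_distrib_left mult_ac)
      moreover have "integral {0..1} (\<lambda>x. d x * cos (2 * pi * x) ^ i) = 0" for i
        using moments[of i 0] by simp
      ultimately show ?thesis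
        by (simp, subst integral_sum) (auto intro!: integrable_continuous_real continuous_intros cont')
    qed
    have contp: "continuous_on {0..1} (\<lambda>x. p (cos (2 * pi * x)))"
      unfolding pn by (intro continuous_intros)
    have "integral {0..1} (\<lambda>x. d x ^ 2) =
       integral {0..1} (\<lambda>x. d x * (d x - p (cos (2 * pi * x))) + d x * p (cos (2 * pi * x)))"
      by (simp add: algebra_simps power2_eq_square)
    also have "\<dots> = integral {0..1} (\<lambda>x. d x * (d x - p (cos (2 * pi * x))))"
      by (subst integral_add) (auto intro!: integrable_continuous_real continuous_intros cont' contp simp: 0)
    also have "\<dots> \<le> integral {0..1} (\<lambda>x::real. B * e')"
    proof (rule integral_le)
      fix x :: real assume x: "x \<in> {0..1}"
      have "\<bar>d x - p (cos (2 * pi * x))\<bar> \<le> e'"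
        using p(2)[of "cos (2 * pi * x)"] dG[OF x] by auto
      then have "\<bar>d x * (d x - p (cos (2 * pi * x)))\<bar> \<le> B * e'"
        unfolding abs_mult using B[OF x] by (intro mult_mono) auto
      then show "d x * (d x - p (cos (2 * pi * x))) \<le> B * e'" by simp
    qed (auto intro!: integrable_continuous_real continuous_intros cont' contp)
    also have "\<dots> \<le> 0 + e" using e' by simp
    finally show "integral {0..1} (\<lambda>x. d x ^ 2) \<le> 0 + e" .
  qed
  moreover have int: "(\<lambda>x. d x ^ 2) integrable_on {0..1}"
    by (auto intro!: integrable_continuous_real continuous_intros cont')
  ultimately have "integral {0..1} (\<lambda>x. d x ^ 2) = 0"
    using integral_nonneg[OF int] by simp
  then have "\<forall>x\<in>{0..1}. d x ^ 2 = 0"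
    by (subst (asm) integral_eq_0_iff) (auto intro!: continuous_intros cont')
  then have "d (frac x) ^ 2 = 0"
    using frac_lt_1[of x] by (auto simp: less_imp_le)
  then show ?thesis using periodic_frac[of d x] per by simp
qed

text \<open>
  The series converges uniformly, so its sum \<open>h\<close> is continuous and has the same cosine coefficients
  as \<open>f\<close>. The difference \<open>f - h\<close> is then zero by uniqueness. The index is shifted by one because a
  function of mean zero has no constant term, and the factor 2 in \<open>a\<close> collects the frequencies
  \<open>k + 1\<close> and \<open>- (k + 1)\<close>.
\<close>

lemma cosine_series:
  fixes f :: "real \<Rightarrow> real" and a :: "nat \<Rightarrow> real"
  assumes per: "\<And>x. f (x + 1) = f x" and cont: "continuous_on UNIV f"
    and even: "\<And>x. f (- x) = f x"
    and mean: "integral {0..1} f = 0"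
    and a: "\<And>k. a k = 2 * integral {0..1} (\<lambda>x. f x * cos (2 * pi * real (Suc k) * x))"
    and summable: "summable (\<lambda>k. \<bar>a k\<bar>)"
  shows "(\<lambda>k. a k * cos (2 * pi * real (Suc k) * t)) sums f t"
proof -
  have cont': "continuous_on S f" for S using cont continuous_on_subset by blast
  define h where "h t = (\<Sum>k. a k * cos (2 * pi * real (Suc k) * t))" for t
  have bd: "norm (a k * cos (2 * pi * real (Suc k) * t)) \<le> \<bar>a k\<bar>" for k t
    by (simp add: abs_mult mult_left_le)
  have sums: "(\<lambda>k. a k * cos (2 * pi * real (Suc k) * t)) sums h t" for t
    unfolding h_def by (intro summable_sums summable_comparison_test[OF _ summable]) (use bd in blast)
  have unif: "uniform_limit UNIV (\<lambda>n t. \<Sum>k<n. a k * cos (2 * pi * real (Suc k) * t)) h sequentially"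
    unfolding h_def by (rule Weierstrass_m_test[OF bd summable])
  have conth: "continuous_on UNIV h"
    by (rule uniform_limit_theorem[OF _ unif]) (auto intro!: always_eventually continuous_intros)
  then have conth': "continuous_on S h" for S using continuous_on_subset by blast
  have coeff: "integral {0..1} (\<lambda>x. h x * cos (2 * pi * real j * x)) =
      (if j = 0 then 0 else a (j - 1) / 2)" for j
  proof -
    have "uniform_limit UNIV
      (\<lambda>n x. \<Sum>k<n. (a k * cos (2 * pi * real (Suc k) * x)) * cos (2 * pi * real j * x))
      (\<lambda>x. \<Sum>k. (a k * cos (2 * pi * real (Suc k) * x)) * cos (2 * pi * real j * x)) sequentially"
    proof (rule Weierstrass_m_test[OF _ summable])
      fix k x
      show "norm ((a k * cos (2 * pi * real (Suc k) * x)) * cos (2 * pi * real j * x)) \<le> \<bar>a k\<bar>"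
        using bd[of k x] mult_left_le[of "\<bar>cos (2 * pi * real j * x)\<bar>" "\<bar>a k * cos (2 * pi * real (Suc k) * x)\<bar>"]
        by (simp add: abs_mult)
    qed
    moreover have "(\<Sum>k. (a k * cos (2 * pi * real (Suc k) * x)) * cos (2 * pi * real j * x)) =
       h x * cos (2 * pi * real j * x)" for x
      using sums_mult2[OF sums] by (rule sums_unique[symmetric])
    ultimately have "uniform_limit {0..1}
      (\<lambda>n x. \<Sum>k<n. (a k * cos (2 * pi * real (Suc k) * x)) * cos (2 * pi * real j * x))
      (\<lambda>x. h x * cos (2 * pi * real j * x)) sequentially"
      using uniform_limit_on_subset by fastforce
    then obtain I J where I: "\<And>n. ((\<lambda>x. \<Sum>k<n. (a k * cos (2 * pi * real (Suc k) * x)) * cos (2 * pi * real j * x)) has_integral I n) {0..1}"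
      and J: "((\<lambda>x. h x * cos (2 * pi * real j * x)) has_integral J) {0..1}" "I \<longlonglongrightarrow> J"
      by (rule uniform_limit_integral) (auto intro!: continuous_intros)
    have "I n = (\<Sum>k<n. if Suc k = j then a k / 2 else 0)" for n
    proof -
      have "I n = integral {0..1} (\<lambda>x. \<Sum>k<n. a k * (cos (2 * pi * real (Suc k) * x) * cos (2 * pi * real j * x)))"
        using I[of n] by (simp add: integral_unique mult.assoc)
      also have "\<dots> = (\<Sum>k<n. a k * integral {0..1} (\<lambda>x. cos (2 * pi * real (Suc k) * x) * cos (2 * pi * real j * x)))"
        by (subst integral_sum) (auto intro!: integrable_continuous_real continuous_intros)
      also have "\<dots> = (\<Sum>k<n. if Suc k = j then a k / 2 else 0)"
        by (intro sum.cong refl, subst cosine_orthogonality) auto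
      finally show ?thesis .
    qed
    moreover have "(\<Sum>k<n. if Suc k = j then a k / 2 else 0) = (if j = 0 then 0 else a (j - 1) / 2)" if "n \<ge> j" for n
      using that by (cases j) (auto simp: sum.delta')
    ultimately have "eventually (\<lambda>n. I n = (if j = 0 then 0 else a (j - 1) / 2)) sequentially"
      unfolding eventually_sequentially by (intro exI[of _ j]) auto
    then have "I \<longlonglongrightarrow> (if j = 0 then 0 else a (j - 1) / 2)" by (rule tendsto_eventually)
    with J have "J = (if j = 0 then 0 else a (j - 1) / 2)" using LIMSEQ_unique by blast
    with J show ?thesis by (simp add: integral_unique)
  qed
  have "f t - h t = 0"
  proof (rule even_periodic_zero_if_cosine_coeffs_zero[where d = "\<lambda>t. f t - h t"])
    fix x
    have "cos (2 * pi * real (Suc k) * (x + 1)) = cos (2 * pi * real (Suc k) * x)" for k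
      using cos_add[of "2 * pi * real (Suc k) * x" "2 * pi * real (Suc k)"] cos_int_2pin[of "int (Suc k)"] sin_int_2pin[of "int (Suc k)"]
      by (simp add: distrib_left del: of_nat_Suc)
    then show "f (x + 1) - h (x + 1) = f x - h x"
      unfolding h_def per by presburger
    show "f (- x) - h (- x) = f x - h x"
      by (simp add: even h_def)
  next
    fix k :: nat
    have "integral {0..1} (\<lambda>x. (f x - h x) * cos (2 * pi * real k * x)) =
      integral {0..1} (\<lambda>x. f x * cos (2 * pi * real k * x)) - integral {0..1} (\<lambda>x. h x * cos (2 * pi * real k * x))"
      unfolding left_diff_distrib
      by (intro integral_diff integrable_continuous_real continuous_intros cont' conth')
    also have "\<dots> = 0"
      unfolding coeff using a[of "k - 1"] mean by (cases k) auto
    finally show "integral {0..1} (\<lambda>x. (f x - h x) * cos (2 * pi * real k * x)) = 0" .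
  qed (intro continuous_intros cont conth)
  with sums[of t] show ?thesis by simp
qed

section \<open>Positive definiteness and oscillation\<close>

text \<open>
  Each frequency contributes the nonnegative multiple \<open>b k\<close> of the squared modulus of the
  exponential sum \<open>\<Sum>i. w i * exp (2 \<pi> \<i> (k + 1) p i)\<close>, written below by its real and imaginary parts.
\<close>

lemma cosine_series_positive_definite:
  fixes f :: "real \<Rightarrow> real" and w p :: "'i \<Rightarrow> real"
  assumes series: "\<And>t. (\<lambda>k. b k * cos (2 * pi * real (Suc k) * t)) sums f t"
    and nonneg: "\<And>k. b k \<ge> 0"
  shows "0 \<le> (\<Sum>i\<in>I. \<Sum>j\<in>I. w i * w j * f (p i - p j))"
proof -
  let ?T = "\<lambda>k. \<Sum>i\<in>I. \<Sum>j\<in>I. w i * w j * (b k * cos (2 * pi * real (Suc k) * (p i - p j)))"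
  have series_form: "?T sums (\<Sum>i\<in>I. \<Sum>j\<in>I. w i * w j * f (p i - p j))"
    by (intro sums_sum sums_mult series)
  have nonneg_terms: "0 \<le> ?T k" for k
  proof -
    let ?q = "\<lambda>i. 2 * pi * real (Suc k) * p i"
    have "?T k = b k * ((\<Sum>i\<in>I. w i * cos (?q i))\<^sup>2 + (\<Sum>i\<in>I. w i * sin (?q i))\<^sup>2)"
      unfolding power2_eq_square sum_product sum.distrib[symmetric] sum_distrib_left[of "b k"]
    proof (intro sum.cong refl)
      fix i j
      have "cos (2 * pi * real (Suc k) * (p i - p j)) = cos (?q i) * cos (?q j) + sin (?q i) * sin (?q j)"
        unfolding right_diff_distrib by (rule cos_diff)
      then have "w i * w j * (b k * cos (2 * pi * real (Suc k) * (p i - p j))) =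
        w i * w j * (b k * (cos (?q i) * cos (?q j) + sin (?q i) * sin (?q j)))" by simp
      also have "x * y * (z * (a * b + c * d)) = z * (x * a * (y * b) + x * c * (y * d))"
        for x y z a b c d :: real
        by (simp add: algebra_simps)
      finally show "w i * w j * (b k * cos (2 * pi * real (Suc k) * (p i - p j))) =
        b k * (w i * cos (?q i) * (w j * cos (?q j)) + w i * sin (?q i) * (w j * sin (?q j)))" .
    qed
    then show ?thesis using nonneg by simp
  qed
  show ?thesis
    by (rule sums_le[OF nonneg_terms sums_zero series_form])
qed

text \<open>
  The quadratic form of \<open>f\<close> is evaluated at the measure with mass 1 at the points \<open>x 1, \<dots>, x n\<close>,
  mass \<open>- \<sigma>\<close> at \<open>u\<close> and mass \<open>\<sigma>\<close> at \<open>v\<close>. Its nonnegativity for all \<open>\<sigma>\<close> is the Cauchy-Schwarz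
  inequality; keeping \<open>\<sigma>\<close> free avoids a square root and the degenerate case \<open>f (u - v) = f 0\<close>.
\<close>

lemma potential_oscillation_le:
  fixes f :: "real \<Rightarrow> real" and x :: "nat \<Rightarrow> real"
  assumes pd: "\<And>w p. 0 \<le> (\<Sum>i\<in>{0..Suc n}. \<Sum>j\<in>{0..Suc n}. w i * w j * f (p i - p j))"
    and even: "\<And>y. f (- y) = f y" and "\<sigma> > 0"
  defines "g \<equiv> \<lambda>y. \<Sum>k=1..n. f (y - x k)"
  shows "g u - g v \<le> (\<Sum>i=1..n. \<Sum>j=1..n. f (x i - x j)) / (2 * \<sigma>) + \<sigma> * (f 0 - f (u - v))"
proof -
  \<comment> \<open>The indices \<open>0\<close> and \<open>Suc n\<close> are free to hold the two additional points.\<close>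
  define p where "p = x(0 := u, Suc n := v)"
  define w where "w = (\<lambda>i. 1)(0 := - \<sigma>, Suc n := \<sigma>)"
  have "{0..Suc n} = insert 0 (insert (Suc n) {1..n})" by auto
  then have split: "sum F {0..Suc n} = F 0 + (F (Suc n) + sum F {1..n})" for F :: "nat \<Rightarrow> real"
    by simp
  have inner: "(\<Sum>j\<in>{0..Suc n}. w j * f (y - p j)) = \<sigma> * f (y - v) - \<sigma> * f (y - u) + g y" for y
    unfolding split by (auto simp: w_def p_def g_def)
  have outer: "(\<Sum>i\<in>{0..Suc n}. w i * h (p i)) = \<sigma> * h v - \<sigma> * h u + (\<Sum>i=1..n. h (x i))" for h
    unfolding split by (auto simp: w_def p_def)
  have g: "(\<Sum>i=1..n. f (x i - y)) = g y" for y
  proof -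
    have "f (x i - y) = f (y - x i)" for i
      using even[of "y - x i"] by simp
    then show ?thesis by (simp add: g_def)
  qed
  have "0 \<le> (\<Sum>i\<in>{0..Suc n}. w i * (\<Sum>j\<in>{0..Suc n}. w j * f (p i - p j)))"
    using pd[of w p] by (simp only: sum_distrib_left mult.assoc)
  also have "\<dots> = \<sigma> * (\<sigma> * f 0 - \<sigma> * f (v - u) + g v) - \<sigma> * (\<sigma> * f (u - v) - \<sigma> * f 0 + g u)
     + (\<Sum>i=1..n. \<sigma> * f (x i - v) - \<sigma> * f (x i - u) + g (x i))"
    unfolding inner by (subst outer[of "\<lambda>y. \<sigma> * f (y - v) - \<sigma> * f (y - u) + g y"]) (simp only: diff_self)
  also have "(\<Sum>i=1..n. \<sigma> * f (x i - v) - \<sigma> * f (x i - u) + g (x i)) =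
      \<sigma> * g v - \<sigma> * g u + (\<Sum>i=1..n. g (x i))"
    by (simp only: sum.distrib sum_subtractf sum_distrib_left[symmetric] g)
  also have "f (v - u) = f (u - v)"
    using even[of "u - v"] by simp
  finally have "2 * \<sigma> * (g u - g v) \<le> (\<Sum>i=1..n. g (x i)) + 2 * \<sigma>\<^sup>2 * (f 0 - f (u - v))"
    by (simp add: algebra_simps power2_eq_square)
  then have "g u - g v \<le> ((\<Sum>i=1..n. g (x i)) + 2 * \<sigma>\<^sup>2 * (f 0 - f (u - v))) / (2 * \<sigma>)"
    using \<open>\<sigma> > 0\<close> by (simp add: pos_le_divide_eq mult_ac)
  also have "\<dots> = (\<Sum>i=1..n. g (x i)) / (2 * \<sigma>) + \<sigma> * (f 0 - f (u - v))"
    using \<open>\<sigma> > 0\<close> by (simp add: add_divide_distrib power2_eq_square)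
  finally show ?thesis unfolding g_def .
qed

lemma one_minus_cos_le: "1 - cos x \<le> x\<^sup>2 / 2" for x :: real
proof -
  have "1 - cos x = 2 * (sin (x / 2))\<^sup>2"
    using cos_double_sin[of "x / 2"] by simp
  also have "\<dots> \<le> 2 * (x / 2)\<^sup>2"
    using power_mono[OF abs_sin_x_le_abs_x[of "x / 2"], of 2] by (simp only: power2_abs) simp
  finally show ?thesis by (simp add: power_divide)
qed

text \<open>
  Frequencies up to about \<open>1 / t\<close> contribute at most \<open>2 \<pi>\<^sup>2 t\<^sup>2\<close> each by the quadratic bound on
  \<open>1 - cos\<close>. Beyond that \<open>1 - cos\<close> is at most 2, and the tail of \<open>\<Sum>k. 2 / k\<^sup>2\<close> telescopes to
  \<open>O(t)\<close>.
\<close>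

lemma sum_one_minus_cos_le:
  assumes t: "0 < t" "t \<le> 1"
  shows "(\<Sum>k<n. (1 - cos (2 * pi * real (Suc k) * t)) / real (Suc k) ^ 2) \<le> (4 * pi\<^sup>2 + 2) * t"
    (is "?S n \<le> _")
proof -
  define N where "N = nat \<lceil>1 / t\<rceil>"
  have N: "1 / t \<le> real N" "real N \<le> 1 / t + 1" "N > 0"
    using t unfolding N_def by (auto intro: real_nat_ceiling_ge) linarith?
  have small: "?S n \<le> 2 * pi\<^sup>2 * t\<^sup>2 * real n" for n
  proof -
    have "(1 - cos (2 * pi * real (Suc k) * t)) / real (Suc k) ^ 2 \<le> 2 * pi\<^sup>2 * t\<^sup>2" for k
      using one_minus_cos_le[of "2 * pi * real (Suc k) * t"]
      by (simp add: pos_divide_le_eq power_mult_distrib mult_ac del: of_nat_Suc)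
    then have "?S n \<le> (\<Sum>k<n. 2 * pi\<^sup>2 * t\<^sup>2)" by (rule sum_mono)
    then show ?thesis by (simp add: mult_ac)
  qed
  have N1: "2 * pi\<^sup>2 * t\<^sup>2 * real N \<le> 4 * pi\<^sup>2 * t"
  proof -
    have "t\<^sup>2 * real N \<le> t\<^sup>2 * (1 / t + 1)" using N by (intro mult_left_mono) auto
    also have "\<dots> = t + t * t" using t by (simp add: field_simps power2_eq_square)
    also have "\<dots> \<le> 2 * t" using t mult_left_le[of t t] by simp
    finally have "2 * pi\<^sup>2 * (t\<^sup>2 * real N) \<le> 2 * pi\<^sup>2 * (2 * t)" by (intro mult_left_mono) auto
    then show ?thesis by (simp add: mult_ac)
  qed
  have N2: "2 / real N \<le> 2 * t" using N t by (simp add: field_simps)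
  show ?thesis
  proof (cases "n \<le> N")
    case True
    have "?S n \<le> 2 * pi\<^sup>2 * t\<^sup>2 * real n" by (rule small)
    also have "\<dots> \<le> 2 * pi\<^sup>2 * t\<^sup>2 * real N" using True by (intro mult_left_mono) auto
    also have "\<dots> \<le> 4 * pi\<^sup>2 * t + 2 * t" using N1 t by linarith
    finally show ?thesis by (simp only: distrib_right)
  next
    case False
    then have "N \<le> n" by simp
    \<comment> \<open>The negative term is what makes the telescoping induction close.\<close>
    then have "?S n \<le> 2 * pi\<^sup>2 * t\<^sup>2 * real N + 2 / real N - 2 / real n"
    proof (induction n rule: dec_induct)
      case base then show ?case using small[of N] by simp
    next
      case (step n)
      have n: "real n > 0" using step N by simp
      have "(1 - cos (2 * pi * real (Suc n) * t)) / real (Suc n) ^ 2 \<le> 2 / real (Suc n) ^ 2"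
        by (intro divide_right_mono) (use cos_ge_minus_one[of "2 * pi * real (Suc n) * t"] in auto)
      also have "\<dots> \<le> 2 / (real n * real (Suc n))"
        using n by (intro divide_left_mono) (auto simp: power2_eq_square)
      also have "\<dots> = 2 / real n - 2 / real (Suc n)"
        using n by (simp add: diff_frac_eq)
      finally show ?case using step.IH unfolding sum.lessThan_Suc by linarith
    qed
    also have "\<dots> \<le> 4 * pi\<^sup>2 * t + 2 * t" using N1 N2 by (smt (verit) divide_nonneg_nonneg of_nat_0_le_iff)
    finally show ?thesis by (simp only: distrib_right)
  qed
qed

text \<open>
  The bound is linear in \<open>t\<close> because coefficients of order \<open>k\<^sup>-\<^sup>2\<close> give a function that may have a
  corner at \<open>0\<close>; combined with \<open>potential_oscillation_le\<close> it yields the exponent 1/2 for potentials.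
\<close>

lemma cosine_series_increment_le:
  fixes f :: "real \<Rightarrow> real"
  assumes series: "\<And>t. (\<lambda>k. b k * cos (2 * pi * real (Suc k) * t)) sums f t"
    and b: "\<And>k. b k \<le> c / real (Suc k) ^ 2" and "c \<ge> 0" and t: "0 \<le> t" "t \<le> 1"
  shows "f 0 - f t \<le> c * (4 * pi\<^sup>2 + 2) * t"
proof (cases "t = 0")
  case False
  then have t: "0 < t" "t \<le> 1" using t by auto
  have sums: "(\<lambda>k. b k * cos (2 * pi * real (Suc k) * 0) - b k * cos (2 * pi * real (Suc k) * t)) sums (f 0 - f t)"
    by (intro sums_diff series)
  show ?thesis
  proof (rule LIMSEQ_le_const2[OF sums[unfolded sums_def]], intro exI allI impI)
    fix n
    have "(\<Sum>k<n. b k * cos (2 * pi * real (Suc k) * 0) - b k * cos (2 * pi * real (Suc k) * t))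
       \<le> (\<Sum>k<n. c * ((1 - cos (2 * pi * real (Suc k) * t)) / real (Suc k) ^ 2))"
    proof (rule sum_mono)
      fix k
      show "b k * cos (2 * pi * real (Suc k) * 0) - b k * cos (2 * pi * real (Suc k) * t)
         \<le> c * ((1 - cos (2 * pi * real (Suc k) * t)) / real (Suc k) ^ 2)"
        using mult_right_mono[OF b[of k], of "1 - cos (2 * pi * real (Suc k) * t)"]
        by (simp add: right_diff_distrib diff_divide_distrib del: of_nat_Suc)
    qed
    also have "\<dots> \<le> c * ((4 * pi\<^sup>2 + 2) * t)"
      unfolding sum_distrib_left[symmetric]
      by (intro mult_left_mono sum_one_minus_cos_le t \<open>c \<ge> 0\<close>)
    finally show "(\<Sum>k<n. b k * cos (2 * pi * real (Suc k) * 0) - b k * cos (2 * pi * real (Suc k) * t))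
       \<le> c * (4 * pi\<^sup>2 + 2) * t" by (simp add: mult_ac)
  qed
qed simp

section \<open>Peaks of functions of mean zero\<close>

text \<open>
  Hypothesis \<open>osc\<close> is a Hoelder condition of exponent 1/2 with constant of order \<open>r\<^sup>3\<^sup>/\<^sup>2\<close>, in the
  form obtained before optimising over \<open>\<sigma>\<close>; in the application \<open>r\<^sup>3 = n\<close>. A value above \<open>C r\<close> at \<open>u\<close>
  forces values above \<open>C r / 2\<close> on an interval of length \<open>1 / r\<close>. The mass \<open>C / 2\<close> of this peak
  exceeds \<open>c\<close>, the most that a function bounded below by \<open>- c\<close> can compensate on a period.
\<close>

lemma mean_zero_sup_bound:
  fixes g :: "real \<Rightarrow> real"
  assumes cont: "continuous_on UNIV g"
    and mean: "integral {u..u+1} g = 0"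
    and lower: "\<And>y. - c \<le> g y" and "c \<ge> 0"
    and osc: "\<And>t \<sigma>. 0 \<le> t \<Longrightarrow> t \<le> 1 \<Longrightarrow> \<sigma> > 0 \<Longrightarrow> g u - g (u + t) \<le> A * r ^ 3 / (2 * \<sigma>) + \<sigma> * (K * t)"
    and "A > 0" "K \<ge> 0" "r \<ge> 1"
    and C: "C \<ge> 1" "C > 2 * c" "C \<ge> 8 * A * K"
  shows "g u \<le> C * r"
proof (rule ccontr)
  assume "\<not> g u \<le> C * r"
  then have u: "g u > C * r" by simp
  define \<delta> where "\<delta> = 1 / r"
  have \<delta>: "0 < \<delta>" "\<delta> \<le> 1" "\<delta> * r = 1" using \<open>r \<ge> 1\<close> by (auto simp: \<delta>_def)
  have peak: "C * r / 2 \<le> g y" if y: "y \<in> {u..u+\<delta>}" for y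
  proof -
    \<comment> \<open>With this choice the first term of \<open>osc\<close> is a quarter of \<open>C r\<close>.\<close>
    define \<sigma> where "\<sigma> = 2 * A * r\<^sup>2 / C"
    have "\<sigma> > 0" using \<open>A > 0\<close> \<open>r \<ge> 1\<close> C(1) by (simp add: \<sigma>_def)
    define t where "t = y - u"
    have t: "0 \<le> t" "t \<le> \<delta>" "t \<le> 1" using y \<delta> by (auto simp: t_def)
    have "g u - g y \<le> A * r ^ 3 / (2 * \<sigma>) + \<sigma> * (K * t)"
      using osc[of t \<sigma>] t \<open>\<sigma> > 0\<close> by (simp add: t_def)
    also have "\<sigma> * (K * t) \<le> \<sigma> * (K * \<delta>)"
      using t \<open>K \<ge> 0\<close> \<open>\<sigma> > 0\<close> by (intro mult_left_mono) auto
    also have "A * r ^ 3 / (2 * \<sigma>) = C * r / 4"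
      using \<open>A > 0\<close> \<open>r \<ge> 1\<close> C(1) by (simp add: \<sigma>_def field_simps power3_eq_cube power2_eq_square)
    also have "\<sigma> * (K * \<delta>) = (8 * A * K) * r / (4 * C)"
      using \<open>r \<ge> 1\<close> C(1) by (simp add: \<sigma>_def \<delta>_def field_simps power2_eq_square)
    also have "\<dots> \<le> C * r / 4"
    proof -
      have "8 * A * K \<le> C * C"
        using C mult_left_mono[of 1 C C] by linarith
      then have "(8 * A * K) * r \<le> (C * C) * r" using \<open>r \<ge> 1\<close> by (intro mult_right_mono) auto
      then show ?thesis using C by (simp add: field_simps)
    qed
    finally show ?thesis using u by simp
  qed
  have int: "g integrable_on {a..b}" for a b
    by (intro integrable_continuous_real continuous_on_subset[OF cont]) auto
  have "\<delta> * (C * r / 2) = integral {u..u+\<delta>} (\<lambda>y. C * r / 2)" using \<delta> by simp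
  also have "\<dots> \<le> integral {u..u+\<delta>} g"
    using peak by (intro integral_le int) auto
  finally have 1: "C / 2 \<le> integral {u..u+\<delta>} g" using \<delta>(3) by (simp add: mult.left_commute[of \<delta> C])
  have "- c \<le> (1 - \<delta>) * (- c)" using \<delta> \<open>c \<ge> 0\<close> by (simp add: algebra_simps)
  also have "\<dots> = integral {u+\<delta>..u+1} (\<lambda>y. - c)" using \<delta> by simp
  also have "\<dots> \<le> integral {u+\<delta>..u+1} g"
    using lower by (intro integral_le int) auto
  finally have "- c \<le> integral {u+\<delta>..u+1} g" .
  moreover have "integral {u..u+\<delta>} g + integral {u+\<delta>..u+1} g = 0"
    using \<delta> Henstock_Kurzweil_Integration.integral_combine[of u "u+\<delta>" "u+1" g] int mean by simp
  ultimately show False using 1 C by linarith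
qed

section \<open>Energy of a greedy sequence\<close>

lemma energy_Suc:
  fixes f :: "real \<Rightarrow> real" and x :: "nat \<Rightarrow> real"
  assumes even: "\<And>y. f (- y) = f y"
  shows "(\<Sum>i=1..Suc n. \<Sum>j=1..Suc n. f (x i - x j)) =
    (\<Sum>i=1..n. \<Sum>j=1..n. f (x i - x j)) + 2 * (\<Sum>k=1..n. f (x (Suc n) - x k)) + f 0"
proof -
  have "f (x i - x (Suc n)) = f (x (Suc n) - x i)" for i
    using even[of "x (Suc n) - x i"] by simp
  then show ?thesis by (simp add: sum.distrib)
qed

text \<open>
  By \<open>energy_Suc\<close>, a value \<open>g\<^sub>n (x (n+1))\<close> below \<open>- f 0\<close> lowers the energy by more than \<open>f 0\<close>. If this
  happened for all large \<open>n\<close>, the energy would tend to minus infinity.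
\<close>

lemma potential_bounded_below_infinitely_often:
  fixes f :: "real \<Rightarrow> real" and x :: "nat \<Rightarrow> real"
  assumes even: "\<And>y. f (- y) = f y"
    and energy_nonneg: "\<And>n. 0 \<le> (\<Sum>i=1..n. \<Sum>j=1..n. f (x i - x j))"
    and pos: "f 0 > 0"
  shows "infinite {n. n \<ge> m \<and> - f 0 \<le> (\<Sum>k=1..n. f (x (Suc n) - x k))}" (is "infinite ?S")
proof
  assume "finite ?S"
  then obtain N0 where N0: "\<And>n. n \<in> ?S \<Longrightarrow> n < N0"
    by (meson finite_nat_set_iff_bounded)
  define N where "N = max N0 m"
  let ?E = "\<lambda>n. \<Sum>i=1..n. \<Sum>j=1..n. f (x i - x j)"
  have drop: "(\<Sum>k=1..n. f (x (Suc n) - x k)) < - f 0" if "n \<ge> N" for n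
    using N0[of n] that by (force simp: N_def)
  have decay: "?E (N + k) \<le> ?E N - real k * f 0" for k
  proof (induction k)
    case (Suc k)
    then show ?case
      using drop[of "N + k"] energy_Suc[of f x "N + k", OF even] by (simp add: algebra_simps)
  qed simp
  obtain k where "?E N < real k * f 0" using reals_Archimedean3[OF pos] by blast
  with decay[of k] energy_nonneg[of "N + k"] show False by simp
qed

text \<open>
  Each step beyond \<open>m\<close> adds at most \<open>f 0\<close>. The arbitrary initial energy is absorbed into the slope,
  which is possible since \<open>n \<ge> 1\<close>.
\<close>

lemma energy_linear_bound:
  fixes f :: "real \<Rightarrow> real" and x :: "nat \<Rightarrow> real"
  assumes even: "\<And>y. f (- y) = f y" and pos: "f 0 > 0"
    and nonpos: "\<And>n. n \<ge> m \<Longrightarrow> (\<Sum>k=1..n. f (x (Suc n) - x k)) \<le> 0"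
    and "n \<ge> m" "n \<ge> 1"
  shows "(\<Sum>i=1..n. \<Sum>j=1..n. f (x i - x j)) \<le> (\<bar>\<Sum>i=1..m. \<Sum>j=1..m. f (x i - x j)\<bar> + f 0) * real n"
proof -
  let ?E = "\<lambda>n. \<Sum>i=1..n. \<Sum>j=1..n. f (x i - x j)"
  have "?E n \<le> \<bar>?E m\<bar> + f 0 * real n"
    using \<open>n \<ge> m\<close>
  proof (induction n rule: dec_induct)
    case base then show ?case using pos by (simp add: add_increasing2)
  next
    case (step n)
    then show ?case
      using nonpos[of n] energy_Suc[of f x n, OF even] by (simp add: algebra_simps)
  qed
  also have "\<bar>?E m\<bar> \<le> \<bar>?E m\<bar> * real n"
    using \<open>n \<ge> 1\<close> by (simp add: mult_le_cancel_left1)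
  finally show ?thesis by (simp add: algebra_simps)
qed

section \<open>Supremum bound for greedy sequences\<close>

(* The Fourier coefficients of an even real function are real, so comparing them with real
   numbers means comparing their real parts. *)
theorem theorem2:
  fixes f :: "real \<Rightarrow> real" and c1 c2 :: real and x :: "nat \<Rightarrow> real" and m :: nat
  assumes periodic: "torus_fun f"
    and cont: "continuous_on UNIV f"
    and even: "\<And>y. f (- y) = f y"
    and mean_zero: "(LINT y|torus. f y) = 0"
    and c_pos: "c1 > 0" "c2 > 0"
    and coeff_bounds: "\<And>k::int. k \<noteq> 0 \<Longrightarrow>
          c1 / real_of_int \<bar>k\<bar> ^ 2 \<le> Re (fourier_coeff f k) \<and>
          Re (fourier_coeff f k) \<le> c2 / real_of_int \<bar>k\<bar> ^ 2"
    and m_pos: "m \<ge> 1"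
    and points: "\<And>n. n \<ge> 1 \<Longrightarrow> x n \<in> {0..<1}"
    and greedy: "\<And>n. n > m \<Longrightarrow>
          is_arg_min (\<lambda>y. \<Sum>k=1..n-1. f (y - x k)) (\<lambda>y. y \<in> {0..<1}) (x n)"
  shows "\<exists>C::real. C > 0 \<and>
          infinite {n::nat. Linf_norm (\<lambda>y. \<Sum>k=1..n. f (y - x k)) \<le> ereal (C * real n powr (1/3))}"
proof -
  have per: "f (y + 1) = f y" for y using periodic by (simp add: torus_fun_def)
  have mean: "integral {0..1} f = 0"
    using mean_zero torus_integral_continuous(2)[OF cont] by simp

  define b where "b k = 2 * Re (fourier_coeff f (int (Suc k)))" for k
  have b_bounds: "0 < b k" "b k \<le> 2 * c2 / real (Suc k) ^ 2" for k
  proof -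
    have "0 < c1 / real (Suc k) ^ 2" using c_pos by simp
    then show "0 < b k" "b k \<le> 2 * c2 / real (Suc k) ^ 2"
      using coeff_bounds[of "int (Suc k)"] by (auto simp: b_def)
  qed
  have "summable (\<lambda>k. \<bar>b k\<bar>)"
  proof (rule summable_comparison_test')
    have "summable (\<lambda>k. inverse (real (Suc k) ^ 2))"
      using inverse_power_summable[of 2, where 'a = real]
        summable_Suc_iff[of "\<lambda>k. inverse (real k ^ 2)"] by simp
    then show "summable (\<lambda>k. 2 * c2 * inverse (real (Suc k) ^ 2))"
      by (rule summable_mult)
    show "norm \<bar>b k\<bar> \<le> 2 * c2 * inverse (real (Suc k) ^ 2)" for k
      using b_bounds[of k] by (simp add: divide_inverse)
  qed
  moreover have "b k = 2 * integral {0..1} (\<lambda>y. f y * cos (2 * pi * real (Suc k) * y))" for k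
    unfolding b_def Re_fourier_coeff[OF cont] by simp
  ultimately have series: "(\<lambda>k. b k * cos (2 * pi * real (Suc k) * t)) sums f t" for t
    by (intro cosine_series per cont even mean)

  have pd: "0 \<le> (\<Sum>i\<in>I. \<Sum>j\<in>I. w i * w j * f (p i - p j))" for I :: "nat set" and w p
    using b_bounds by (intro cosine_series_positive_definite[OF series]) (simp add: less_imp_le)
  have energy_nonneg: "0 \<le> (\<Sum>i=1..n. \<Sum>j=1..n. f (x i - x j))" for n
    using pd[where I = "{1..n}" and w = "\<lambda>_. 1" and p = x] by simp
  have f0: "f 0 > 0"
    using series[of 0] suminf_pos[of b] b_bounds sums_iff by fastforce

  define g where "g n y = (\<Sum>k=1..n. f (y - x k))" for n y
  have cont_g: "continuous_on S (g n)" for n S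
    unfolding g_def by (intro continuous_intros continuous_on_compose2[OF cont]) auto
  have per_g: "g n (y + 1) = g n y" for n y
    unfolding g_def using per[of "y - x _"] by (intro sum.cong refl) (simp add: algebra_simps)
  have mean_g: "integral {u..u+1} (g n) = 0" for n u
  proof -
    have "integral {u..u+1} (\<lambda>y. f (y - x k)) = 0" for k
      using integral_shift_real_ivl[of "u - x k" "- x k" "u - x k + 1" f]
        periodic_integral_shift[of f "u - x k", OF per cont] mean by (simp add: algebra_simps)
    moreover have "integral {u..u+1} (g n) = (\<Sum>k=1..n. integral {u..u+1} (\<lambda>y. f (y - x k)))"
      unfolding g_def
      by (intro integral_sum integrable_continuous_real continuous_on_compose2[OF cont] continuous_intros) auto
    ultimately show ?thesis by simp
  qed
  have minimal: "g n (x (Suc n)) \<le> g n y" if "n \<ge> m" for n y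
    using greedy[of "Suc n"] that frac_lt_1[of y] periodic_frac[of "g n" y, OF per_g]
    by (auto simp: is_arg_min_linorder g_def dest!: spec[of _ "frac y"])
  have nonpos: "g n (x (Suc n)) \<le> 0" if "n \<ge> m" for n
  proof -
    have "integral {0..1} (\<lambda>y::real. g n (x (Suc n))) \<le> integral {0..1} (g n)"
      using minimal[OF that] by (intro integral_le integrable_continuous_real cont_g) auto
    then show ?thesis using mean_g[of 0 n] by simp
  qed

  \<comment> \<open>\<open>A\<close> is the slope of the energy bound and \<open>K\<close> bounds the rate of decrease of \<open>f\<close> from \<open>0\<close>; \<open>C\<close> is a sum so that
    it dominates the three quantities that \<open>mean_zero_sup_bound\<close> requires.\<close>
  define A where "A = \<bar>\<Sum>i=1..m. \<Sum>j=1..m. f (x i - x j)\<bar> + f 0"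
  define K where "K = 2 * c2 * (4 * pi\<^sup>2 + 2)"
  define C where "C = 1 + 2 * f 0 + 8 * A * K"
  have A: "A > 0" using f0 by (simp add: A_def)
  have K: "K \<ge> 0" using c_pos by (simp add: K_def)
  have AK: "A * K \<ge> 0" using A K by simp
  have C: "C \<ge> 1" "C > 2 * f 0" "C \<ge> 8 * A * K" using f0 AK by (auto simp: C_def mult.assoc)

  have sup: "Linf_norm (g n) \<le> ereal (C * real n powr (1/3))"
    if n: "n \<ge> m" and low: "- f 0 \<le> g n (x (Suc n))" for n
  proof -
    define r where "r = real n powr (1/3)"
    have n1: "n \<ge> 1" using n m_pos by simp
    then have r1: "r \<ge> 1" by (simp add: r_def ge_one_powr_ge_zero)
    have r3: "r ^ 3 = real n"
    proof -
      have "r ^ 3 = r powr 3" using r1 powr_realpow[of r 3] by simp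
      also have "\<dots> = real n" using n1 by (simp add: r_def powr_powr)
      finally show ?thesis .
    qed
    have lower: "- f 0 \<le> g n y" for y using low minimal[OF n, of y] by simp
    have upper: "g n u \<le> C * r" for u
    proof (rule mean_zero_sup_bound[where g = "g n" and u = u and c = "f 0" and A = A and K = K])
      fix t \<sigma> :: real assume t: "0 \<le> t" "t \<le> 1" and \<sigma>: "\<sigma> > 0"
      have "g n u - g n (u + t) \<le>
          (\<Sum>i=1..n. \<Sum>j=1..n. f (x i - x j)) / (2 * \<sigma>) + \<sigma> * (f 0 - f (u - (u + t)))"
        unfolding g_def by (rule potential_oscillation_le[OF pd even \<sigma>])
      also have "(\<Sum>i=1..n. \<Sum>j=1..n. f (x i - x j)) / (2 * \<sigma>) \<le> A * r ^ 3 / (2 * \<sigma>)"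
        unfolding r3 A_def using \<sigma> nonpos n n1
        by (intro divide_right_mono energy_linear_bound even f0) (auto simp: g_def)
      also have "\<sigma> * (f 0 - f (u - (u + t))) \<le> \<sigma> * (K * t)"
        using cosine_series_increment_le[OF series b_bounds(2) _ t] c_pos \<sigma> even[of t]
        by (intro mult_left_mono) (auto simp: K_def)
      finally show "g n u - g n (u + t) \<le> A * r ^ 3 / (2 * \<sigma>) + \<sigma> * (K * t)" by simp
    qed (use cont_g mean_g lower f0 A K r1 C in auto)
    have "f 0 \<le> C * 1" using C f0 by simp
    also have "\<dots> \<le> C * r" using r1 C by (intro mult_left_mono) auto
    finally have "\<bar>g n y\<bar> \<le> C * r" for y using upper[of y] lower[of y] by (simp add: abs_le_iff)
    moreover have "(\<lambda>y. ereal \<bar>g n y\<bar>) \<in> borel_measurable torus"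
    proof -
      have "g n \<in> borel_measurable borel"
        by (rule borel_measurable_continuous_onI[OF cont_g])
      then have "g n \<in> borel_measurable torus"
        unfolding torus_def by (intro measurable_restrict_space1 measurable_completion) simp
      then show ?thesis by measurable
    qed
    ultimately show ?thesis
      unfolding Linf_norm_def r_def[symmetric] by (intro esssup_I) auto
  qed

  have "infinite {n. n \<ge> m \<and> - f 0 \<le> g n (x (Suc n))}"
    unfolding g_def by (rule potential_bounded_below_infinitely_often[OF even energy_nonneg f0])
  then have "infinite {n. Linf_norm (g n) \<le> ereal (C * real n powr (1/3))}"
    by (rule contrapos_nn) (rule finite_subset[rotated], assumption, use sup in auto)
  moreover have "C > 0" using C by simp
  ultimately show ?thesis unfolding g_def by blast
qed

end
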